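(* Let $G$ be a topological group, $S\subset G$ a closed subgroup, and $G/S$ the set of all left cosets $gS$, regarded as a subset of the hyperspace $\mathcal{H}(G)$ of nonempty closed subsets of $G$. Let $\mathcal{V}$ be a basis of symmetric open neighborhoods at the identity of $G$, let $\mathcal{U}_{V}=\{Vg: g\in G\}$ for $V\in\mathcal{V}$, and endow $G$ with the admissible family $\mathcal{O}=\{\mathcal{U}_{V}:V\in\mathcal{V}\}$. Then the quotient topology on $G/S$ coincides with the uniform topology induced from $\mathcal{H}(G)$, and the quotient map $\pi:G\rightarrow G/S$, $\pi(g)=gS$, is uniformly continuous (with respect to the uniformity on $G$ given by $\mathcal{O}$ and the uniformity on $G/S$ induced from $\mathcal{H}(G)$).
   Context: Stars: $\mathrm{St}[Y,\mathcal{U}]=\bigcup\{U\in\mathcal{U}: Y\cap U\neq\emptyset\}$ for $Y\subset G$ and $\mathcal{U}$ a covering of $G$; $\mathrm{St}[g,\mathcal{U}]=\mathrm{St}[\{g\},\mathcal{U}]$. Here $\mathrm{St}[g,\mathcal{U}_{V}]=V^{2}g$. A family $\mathcal{O}$ of open coverings is admissible if (1) for any $\mathcal{U},\mathcal{V}\in\mathcal{O}$ there is $\mathcal{W}\in\mathcal{O}$ such that whenever two members of $\mathcal{W}$ intersect, their union is contained in a member of $\mathcal{U}$ and in a member of $\mathcal{V}$; and (2) the stars of points with respect to the coverings in $\mathcal{O}$ form a basis for the topology. The family $\mathcal{O}=\{\mathcal{U}_{V}\}$ is admissible; the uniformity on $G$ given by $\mathcal{O}$ is the covering uniformity having $\mathcal{O}$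 as a base. The uniformity on $\mathcal{H}(G)$ is the diagonal uniformity with base the sets $D_{\mathcal{U}}=\bigcup\{\mathrm{B}_{H}(A,\mathcal{U})\times\mathrm{B}_{H}(A,\mathcal{U}):A\in\mathcal{H}(G)\}$, $\mathcal{U}\in\mathcal{O}$, where $\mathrm{B}_{H}(A,\mathcal{U})=\{B\in\mathcal{H}(G): A\subset\mathrm{St}[B,\mathcal{U}],\ B\subset\mathrm{St}[A,\mathcal{U}]\}$; the uniform topology is the topology it generates, and $G/S$ receives the subspace uniformity and topology. The quotient topology on $G/S$ is the one making $\pi$ a topological quotient map. *)

theory Defs
  imports "HOL-Analysis.Analysis" "HOL-Algebra.Left_Coset"
begin

section \<open>Topological groups and quotient topologies\<close>

text \<open>No separation axiom is assumed.\<close>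

locale topological_group = group G for G (structure) +
  fixes T :: "'a topology"
  assumes topspace_eq: "topspace T = carrier G"
    and continuous_mult: "continuous_map (prod_topology T T) T (\<lambda>(x, y). x \<otimes> y)"
    and continuous_inv: "continuous_map T T (\<lambda>x. inv x)"

definition symmetric_nhd_basis :: "('a, 'b) monoid_scheme \<Rightarrow> 'a topology \<Rightarrow> 'a set set \<Rightarrow> bool" where
  "symmetric_nhd_basis G T \<V> \<longleftrightarrow>
     (\<forall>V\<in>\<V>. openin T V \<and> \<one>\<^bsub>G\<^esub> \<in> V \<and> set_inv\<^bsub>G\<^esub> V = V) \<and>
     (\<forall>W. openin T W \<and> \<one>\<^bsub>G\<^esub> \<in> W \<longrightarrow> (\<exists>V\<in>\<V>. V \<subseteq> W))"

definition quotient_topology :: "'a topology \<Rightarrow> ('a \<Rightarrow> 'b) \<Rightarrow> 'b topology" where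
  "quotient_topology X f =
     topology (\<lambda>U. U \<subseteq> f ` topspace X \<and> openin X {x \<in> topspace X. f x \<in> U})"

lemma openin_quotient_topology:
  "openin (quotient_topology X f) U \<longleftrightarrow>
     U \<subseteq> f ` topspace X \<and> openin X {x \<in> topspace X. f x \<in> U}"
proof -
  have "istopology (\<lambda>U. U \<subseteq> f ` topspace X \<and> openin X {x \<in> topspace X. f x \<in> U})"
    unfolding istopology_def
  proof (intro conjI allI impI; (elim conjE)?)
    fix A B assume "openin X {x \<in> topspace X. f x \<in> A}" "openin X {x \<in> topspace X. f x \<in> B}"
    then have "openin X ({x \<in> topspace X. f x \<in> A} \<inter> {x \<in> topspace X. f x \<in> B})" by blast
    moreover have "{x \<in> topspace X. f x \<in> A} \<inter> {x \<in> topspace X. f x \<in> B}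
        = {x \<in> topspace X. f x \<in> A \<inter> B}" by blast
    ultimately show "openin X {x \<in> topspace X. f x \<in> A \<inter> B}" by simp
  next
    fix K assume K: "\<forall>A\<in>K. A \<subseteq> f ` topspace X \<and> openin X {x \<in> topspace X. f x \<in> A}"
    then have "openin X (\<Union>A\<in>K. {x \<in> topspace X. f x \<in> A})" by blast
    moreover have "(\<Union>A\<in>K. {x \<in> topspace X. f x \<in> A}) = {x \<in> topspace X. f x \<in> \<Union>K}" by blast
    ultimately show "openin X {x \<in> topspace X. f x \<in> \<Union>K}" by simp
  qed blast+
  then show ?thesis by (simp add: quotient_topology_def)
qed

lemma topspace_quotient_topology: "topspace (quotient_topology X f) = f ` topspace X"
proof -
  have "{x \<in> topspace X. f x \<in> f ` topspace X} = topspace X" by blast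
  then have "openin (quotient_topology X f) (f ` topspace X)"
    by (simp add: openin_quotient_topology)
  then show ?thesis
    by (meson openin_quotient_topology openin_subset openin_topspace subset_antisym)
qed

lemma quotient_map_quotient_topology: "quotient_map X (quotient_topology X f) f"
  by (auto simp: quotient_map_def topspace_quotient_topology openin_quotient_topology)

lemma quotient_topology_unique:
  assumes "quotient_map X Y f" shows "Y = quotient_topology X f"
  using assms openin_subset unfolding quotient_map_def topology_eq openin_quotient_topology by metis


section \<open>Uniformities on a set\<close>

text \<open>
  A diagonal uniformity on a set is represented, as for the type class of uniform
  spaces, by its filter of entourages, here a filter concentrated on \<open>X \<times> X\<close>.
\<close>

definition diagonal_uniformity :: "'a set \<Rightarrow> ('a \<times> 'a) filter \<Rightarrow> bool" where
  "diagonal_uniformity X D \<longleftrightarrow>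
     D \<le> principal (X \<times> X) \<and>
     (\<forall>E. eventually E D \<longrightarrow> (\<forall>x\<in>X. E (x, x))) \<and>
     (\<forall>E. eventually E D \<longrightarrow> eventually (\<lambda>(x, y). E (y, x)) D) \<and>
     (\<forall>E. eventually E D \<longrightarrow>
        (\<exists>F. eventually F D \<and> (\<forall>x y z. F (x, y) \<longrightarrow> F (y, z) \<longrightarrow> E (x, z))))"

definition uniform_topology :: "'a set \<Rightarrow> ('a \<times> 'a) filter \<Rightarrow> 'a topology" where
  "uniform_topology X D =
     topology (\<lambda>U. U \<subseteq> X \<and> (\<forall>x\<in>U. eventually (\<lambda>(x', y). x' = x \<longrightarrow> y \<in> U) D))"

lemma openin_uniform_topology:
  "openin (uniform_topology X D) U \<longleftrightarrow>
     U \<subseteq> X \<and> (\<forall>x\<in>U. eventually (\<lambda>(x', y). x' = x \<longrightarrow> y \<in> U) D)"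
proof -
  have "istopology (\<lambda>U. U \<subseteq> X \<and> (\<forall>x\<in>U. eventually (\<lambda>(x', y). x' = x \<longrightarrow> y \<in> U) D))"
    unfolding istopology_def
  proof (intro conjI allI impI ballI; (elim conjE)?)
    fix A B x assume "x \<in> A \<inter> B"
      and A: "\<forall>x\<in>A. eventually (\<lambda>(x', y). x' = x \<longrightarrow> y \<in> A) D"
      and B: "\<forall>x\<in>B. eventually (\<lambda>(x', y). x' = x \<longrightarrow> y \<in> B) D"
    then have "eventually (\<lambda>(x', y). x' = x \<longrightarrow> y \<in> A) D"
      "eventually (\<lambda>(x', y). x' = x \<longrightarrow> y \<in> B) D" by auto
    then show "eventually (\<lambda>(x', y). x' = x \<longrightarrow> y \<in> A \<inter> B) D"
      by (rule eventually_elim2) auto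
  next
    fix K x
    assume K: "\<forall>A\<in>K. A \<subseteq> X \<and> (\<forall>x\<in>A. eventually (\<lambda>(x', y). x' = x \<longrightarrow> y \<in> A) D)"
      and "x \<in> \<Union>K"
    then obtain A where "A \<in> K" "eventually (\<lambda>(x', y). x' = x \<longrightarrow> y \<in> A) D" by blast
    then show "eventually (\<lambda>(x', y). x' = x \<longrightarrow> y \<in> \<Union>K) D"
      by (auto elim!: eventually_mono)
  qed blast+
  then show ?thesis by (simp add: uniform_topology_def)
qed

definition subspace_uniformity :: "('a \<times> 'a) filter \<Rightarrow> 'a set \<Rightarrow> ('a \<times> 'a) filter" where
  "subspace_uniformity D Y = inf D (principal (Y \<times> Y))"

definition uniformly_continuous_between ::
  "'a set \<Rightarrow> ('a \<times> 'a) filter \<Rightarrow> 'b set \<Rightarrow> ('b \<times> 'b) filter \<Rightarrow> ('a \<Rightarrow> 'b) \<Rightarrow> bool" where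
  "uniformly_continuous_between X D Y E f \<longleftrightarrow>
     f ` X \<subseteq> Y \<and> filterlim (\<lambda>(x, y). (f x, f y)) E D"


section \<open>Coverings\<close>

definition star :: "'a set \<Rightarrow> 'a set set \<Rightarrow> 'a set" where
  "star Y \<U> = \<Union>{U \<in> \<U>. Y \<inter> U \<noteq> {}}"

definition open_covering :: "'a topology \<Rightarrow> 'a set set \<Rightarrow> bool" where
  "open_covering T \<U> \<longleftrightarrow> (\<forall>U\<in>\<U>. openin T U) \<and> \<Union>\<U> = topspace T"

definition admissible :: "'a topology \<Rightarrow> 'a set set set \<Rightarrow> bool" where
  "admissible T \<O> \<longleftrightarrow>
     (\<forall>\<U>\<in>\<O>. open_covering T \<U>) \<and>
     (\<forall>\<U>\<in>\<O>. \<forall>\<V>\<in>\<O>. \<exists>\<W>\<in>\<O>. \<forall>A\<in>\<W>. \<forall>B\<in>\<W>. A \<inter> B \<noteq> {} \<longrightarrow>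
        (\<exists>U\<in>\<U>. A \<union> B \<subseteq> U) \<and> (\<exists>V\<in>\<V>. A \<union> B \<subseteq> V)) \<and>
     (\<forall>\<U>\<in>\<O>. \<forall>x\<in>topspace T. openin T (star {x} \<U>)) \<and>
     (\<forall>W x. openin T W \<and> x \<in> W \<longrightarrow>
        (\<exists>\<U>\<in>\<O>. \<exists>y\<in>topspace T. x \<in> star {y} \<U> \<and> star {y} \<U> \<subseteq> W))"

definition covering_uniformity_with_base :: "'a set \<Rightarrow> 'a set set set \<Rightarrow> 'a set set set" where
  "covering_uniformity_with_base X \<O> =
     {\<C>. \<Union>\<C> = X \<and> (\<exists>\<U>\<in>\<O>. \<forall>U\<in>\<U>. \<exists>C\<in>\<C>. U \<subseteq> C)}"

text \<open>
  The standard passage from covering uniformities to diagonal uniformities: the sets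
  \<open>\<Union>{C \<times> C | C \<in> \<C>}\<close>, for \<open>\<C>\<close> a uniform covering, form a base of entourages.
\<close>

definition entourages_of_coverings :: "'a set set set \<Rightarrow> ('a \<times> 'a) filter" where
  "entourages_of_coverings \<CC> = (INF \<C>\<in>\<CC>. principal (\<Union>C\<in>\<C>. C \<times> C))"


section \<open>The hyperspace of nonempty closed sets\<close>

definition hyperspace :: "'a topology \<Rightarrow> 'a set set" where
  "hyperspace T = {A. closedin T A \<and> A \<noteq> {}}"

definition hyper_ball :: "'a topology \<Rightarrow> 'a set \<Rightarrow> 'a set set \<Rightarrow> 'a set set" where
  "hyper_ball T A \<U> = {B \<in> hyperspace T. A \<subseteq> star B \<U> \<and> B \<subseteq> star A \<U>}"

definition hyper_entourage :: "'a topology \<Rightarrow> 'a set set \<Rightarrow> ('a set \<times> 'a set) set" where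
  "hyper_entourage T \<U> = (\<Union>A\<in>hyperspace T. hyper_ball T A \<U> \<times> hyper_ball T A \<U>)"

definition hyperspace_uniformity :: "'a topology \<Rightarrow> 'a set set set \<Rightarrow> ('a set \<times> 'a set) filter" where
  "hyperspace_uniformity T \<O> = (INF \<U>\<in>\<O>. principal (hyper_entourage T \<U>))"


section \<open>The coverings of a topological group by right translates\<close>

text \<open>
  For an arbitrary set \<open>V\<close> of group elements, \<open>rcosets V\<close> is the family of all \<open>V #> g\<close>,
  that is, of all right translates \<open>{v \<otimes> g | v \<in> V}\<close>.
\<close>

definition translate_coverings :: "('a, 'b) monoid_scheme \<Rightarrow> 'a set set \<Rightarrow> 'a set set set" where
  "translate_coverings G \<V> = {rcosets\<^bsub>G\<^esub> V | V. V \<in> \<V>}"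


section \<open>The notions above are well behaved\<close>

lemma subtopology_uniform_topology:
  assumes "diagonal_uniformity X D" "Y \<subseteq> X"
  shows "subtopology (uniform_topology X D) Y = uniform_topology Y (subspace_uniformity D Y)"
  unfolding topology_eq openin_subtopology
proof (intro allI iffI)
  fix U assume "\<exists>W. openin (uniform_topology X D) W \<and> U = W \<inter> Y"
  then obtain W where W: "\<forall>x\<in>W. eventually (\<lambda>(x', y). x' = x \<longrightarrow> y \<in> W) D" "U = W \<inter> Y"
    unfolding openin_uniform_topology by auto
  have "eventually (\<lambda>(x', y). x' = x \<longrightarrow> y \<in> U) (subspace_uniformity D Y)" if "x \<in> U" for x
  proof -
    have "eventually (\<lambda>(x', y). x' = x \<longrightarrow> y \<in> W) D" using W that by auto
    then show ?thesis
      unfolding subspace_uniformity_def eventually_inf_principal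
      by (rule eventually_mono) (auto simp: W(2))
  qed
  then show "openin (uniform_topology Y (subspace_uniformity D Y)) U"
    using W(2) unfolding openin_uniform_topology by auto
next
  fix U assume "openin (uniform_topology Y (subspace_uniformity D Y)) U"
  then have UY: "U \<subseteq> Y"
    and "\<forall>x\<in>U. eventually (\<lambda>(x', y). x' = x \<longrightarrow> y \<in> U) (subspace_uniformity D Y)"
    unfolding openin_uniform_topology by auto
  then have U: "eventually (\<lambda>(x', y). x' = x \<longrightarrow> y \<in> Y \<longrightarrow> y \<in> U) D" if "x \<in> U" for x
    using that UY unfolding subspace_uniformity_def eventually_inf_principal
    by (auto elim!: eventually_mono)
  define W where "W = {x \<in> X. eventually (\<lambda>(x', y). x' = x \<longrightarrow> y \<in> Y \<longrightarrow> y \<in> U) D}"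
  have "eventually (\<lambda>(x', y). x' = x \<longrightarrow> y \<in> W) D" if "x \<in> W" for x
  proof -
    let ?E = "\<lambda>(x', y). x' = x \<longrightarrow> y \<in> Y \<longrightarrow> y \<in> U"
    have "eventually ?E D" using that unfolding W_def by simp
    then have "\<exists>F. eventually F D \<and> (\<forall>x y z. F (x, y) \<longrightarrow> F (y, z) \<longrightarrow> ?E (x, z))"
      using assms(1) unfolding diagonal_uniformity_def by (elim conjE) (erule allE, erule impE)
    then obtain F where F: "eventually F D" "\<And>x y z. F (x, y) \<Longrightarrow> F (y, z) \<Longrightarrow> ?E (x, z)"
      by auto
    have "eventually (\<lambda>p. p \<in> X \<times> X) D"
      using assms(1) unfolding diagonal_uniformity_def le_principal by simp
    with F(1) show ?thesis
    proof (rule eventually_elim2, safe)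
      fix y assume y: "F (x, y)" "y \<in> X"
      have "eventually (\<lambda>(y', z). y' = y \<longrightarrow> z \<in> Y \<longrightarrow> z \<in> U) D"
        using F(1) by (rule eventually_mono) (use F(2)[OF y(1)] in auto)
      then show "y \<in> W" using y(2) unfolding W_def by simp
    qed
  qed
  then have "openin (uniform_topology X D) W"
    unfolding openin_uniform_topology by (auto simp: W_def)
  moreover have "U = W \<inter> Y"
  proof
    show "U \<subseteq> W \<inter> Y" using U UY assms(2) unfolding W_def by auto
    show "W \<inter> Y \<subseteq> U"
    proof
      fix x assume x: "x \<in> W \<inter> Y"
      then have "eventually (\<lambda>(x', y). x' = x \<longrightarrow> y \<in> Y \<longrightarrow> y \<in> U) D" "x \<in> X"
        unfolding W_def by auto
      then have "(\<lambda>(x', y). x' = x \<longrightarrow> y \<in> Y \<longrightarrow> y \<in> U) (x, x)"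
        using assms(1) unfolding diagonal_uniformity_def by blast
      then show "x \<in> U" using x by simp
    qed
  qed
  ultimately show "\<exists>W. openin (uniform_topology X D) W \<and> U = W \<inter> Y" by blast
qed

lemma admissible_covering:
  "admissible T \<O> \<Longrightarrow> \<U> \<in> \<O> \<Longrightarrow> open_covering T \<U>"
  by (simp add: admissible_def)

lemma admissible_Union: "admissible T \<O> \<Longrightarrow> \<U> \<in> \<O> \<Longrightarrow> \<Union>\<U> = topspace T"
  by (simp add: admissible_def open_covering_def)

lemma admissible_common_refinement:
  assumes "admissible T \<O>" "\<U> \<in> \<O>" "\<V> \<in> \<O>"
  obtains \<W> where "\<W> \<in> \<O>"
    "\<And>A B. A \<in> \<W> \<Longrightarrow> B \<in> \<W> \<Longrightarrow> A \<inter> B \<noteq> {} \<Longrightarrow> \<exists>U\<in>\<U>. A \<union> B \<subseteq> U"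
    "\<And>A B. A \<in> \<W> \<Longrightarrow> B \<in> \<W> \<Longrightarrow> A \<inter> B \<noteq> {} \<Longrightarrow> \<exists>V\<in>\<V>. A \<union> B \<subseteq> V"
proof -
  have "\<exists>\<W>\<in>\<O>. \<forall>A\<in>\<W>. \<forall>B\<in>\<W>. A \<inter> B \<noteq> {} \<longrightarrow>
        (\<exists>U\<in>\<U>. A \<union> B \<subseteq> U) \<and> (\<exists>V\<in>\<V>. A \<union> B \<subseteq> V)"
    using assms unfolding admissible_def by blast
  then show ?thesis using that by (elim bexE) simp
qed

lemma admissible_star_refinement:
  assumes "admissible T \<O>" "\<U> \<in> \<O>"
  obtains \<W> where "\<W> \<in> \<O>"
    "\<And>A B. A \<in> \<W> \<Longrightarrow> B \<in> \<W> \<Longrightarrow> A \<inter> B \<noteq> {} \<Longrightarrow> \<exists>U\<in>\<U>. A \<union> B \<subseteq> U"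
  by (rule admissible_common_refinement[OF assms assms(2)]) (rule that)

lemma admissible_directed:
  assumes "admissible T \<O>" "\<U> \<in> \<O>" "\<V> \<in> \<O>"
  obtains \<W> where "\<W> \<in> \<O>"
    "\<And>A. A \<in> \<W> \<Longrightarrow> A \<noteq> {} \<Longrightarrow> \<exists>U\<in>\<U>. A \<subseteq> U"
    "\<And>A. A \<in> \<W> \<Longrightarrow> A \<noteq> {} \<Longrightarrow> \<exists>V\<in>\<V>. A \<subseteq> V"
proof (rule admissible_common_refinement[OF assms])
  fix \<W> assume W: "\<W> \<in> \<O>"
    "\<And>A B. A \<in> \<W> \<Longrightarrow> B \<in> \<W> \<Longrightarrow> A \<inter> B \<noteq> {} \<Longrightarrow> \<exists>U\<in>\<U>. A \<union> B \<subseteq> U"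
    "\<And>A B. A \<in> \<W> \<Longrightarrow> B \<in> \<W> \<Longrightarrow> A \<inter> B \<noteq> {} \<Longrightarrow> \<exists>V\<in>\<V>. A \<union> B \<subseteq> V"
  show thesis
  proof (rule that[OF W(1)])
    show "\<exists>U\<in>\<U>. A \<subseteq> U" if "A \<in> \<W>" "A \<noteq> {}" for A using W(2)[of A A] that by simp
    show "\<exists>V\<in>\<V>. A \<subseteq> V" if "A \<in> \<W>" "A \<noteq> {}" for A using W(3)[of A A] that by simp
  qed
qed

lemma star_mono:
  assumes "\<And>A. A \<in> \<W> \<Longrightarrow> A \<noteq> {} \<Longrightarrow> \<exists>U\<in>\<U>. A \<subseteq> U"
  shows "star Y \<W> \<subseteq> star Y \<U>"
proof
  fix x assume "x \<in> star Y \<W>"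
  then obtain A where "A \<in> \<W>" "Y \<inter> A \<noteq> {}" "x \<in> A" unfolding star_def by blast
  moreover then obtain U where "U \<in> \<U>" "A \<subseteq> U" using assms by blast
  ultimately show "x \<in> star Y \<U>" unfolding star_def by blast
qed

lemma star_covering: "Y \<subseteq> \<Union>\<U> \<Longrightarrow> Y \<subseteq> star Y \<U>"
  unfolding star_def by blast

lemma eventually_hyperspace_uniformity:
  assumes "admissible T \<O>" "\<O> \<noteq> {}"
  shows "eventually P (hyperspace_uniformity T \<O>) \<longleftrightarrow> (\<exists>\<U>\<in>\<O>. \<forall>p\<in>hyper_entourage T \<U>. P p)"
proof -
  have "\<exists>\<W>\<in>\<O>. principal (hyper_entourage T \<W>) \<le>
      inf (principal (hyper_entourage T \<U>)) (principal (hyper_entourage T \<V>))"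
    if UV: "\<U> \<in> \<O>" "\<V> \<in> \<O>" for \<U> \<V>
  proof -
    obtain \<W> where W: "\<W> \<in> \<O>" "\<And>A. A \<in> \<W> \<Longrightarrow> A \<noteq> {} \<Longrightarrow> \<exists>U\<in>\<U>. A \<subseteq> U"
      "\<And>A. A \<in> \<W> \<Longrightarrow> A \<noteq> {} \<Longrightarrow> \<exists>V\<in>\<V>. A \<subseteq> V"
      using admissible_directed[OF assms(1) UV] by metis
    have "star Y \<W> \<subseteq> star Y \<U>" "star Y \<W> \<subseteq> star Y \<V>" for Y
      using star_mono W by metis+
    then have "hyper_ball T A \<W> \<subseteq> hyper_ball T A \<U>" "hyper_ball T A \<W> \<subseteq> hyper_ball T A \<V>" for A
      unfolding hyper_ball_def by blast+
    then have "hyper_entourage T \<W> \<subseteq> hyper_entourage T \<U> \<inter> hyper_entourage T \<V>"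
      unfolding hyper_entourage_def by blast
    then show ?thesis using W(1) by auto
  qed
  then show ?thesis
    unfolding hyperspace_uniformity_def
    by (subst eventually_INF_base) (use assms(2) in \<open>auto simp: eventually_principal\<close>)
qed

lemma hyper_entourage_sym: "(A, B) \<in> hyper_entourage T \<U> \<Longrightarrow> (B, A) \<in> hyper_entourage T \<U>"
  unfolding hyper_entourage_def by blast

lemma hyper_entourage_refl:
  assumes "open_covering T \<U>" "A \<in> hyperspace T"
  shows "(A, A) \<in> hyper_entourage T \<U>"
proof -
  have "A \<subseteq> topspace T"
    using assms(2) closedin_subset unfolding hyperspace_def by auto
  then have "A \<subseteq> \<Union>\<U>" using assms(1) unfolding open_covering_def by simp
  then have "A \<in> hyper_ball T A \<U>"
    using assms(2) star_covering[of A \<U>] unfolding hyper_ball_def by simp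
  then show ?thesis using assms(2) unfolding hyper_entourage_def by blast
qed

lemma hyper_entourage_comp:
  assumes W: "\<And>A B. A \<in> \<W> \<Longrightarrow> B \<in> \<W> \<Longrightarrow> A \<inter> B \<noteq> {} \<Longrightarrow> \<exists>U\<in>\<U>. A \<union> B \<subseteq> U"
    and "(A, B) \<in> hyper_entourage T \<W>" "(B, C) \<in> hyper_entourage T \<W>"
  shows "(A, C) \<in> hyper_entourage T \<U>"
proof -
  have star: "X \<subseteq> star Z \<U>" if XY: "X \<subseteq> star Y \<W>" and YZ: "Y \<subseteq> star Z \<W>" for X Y Z
  proof
    fix x assume "x \<in> X"
    then obtain P y where P: "P \<in> \<W>" "x \<in> P" "y \<in> P" "y \<in> Y"
      using XY unfolding star_def by blast
    then obtain Q z where Q: "Q \<in> \<W>" "y \<in> Q" "z \<in> Q" "z \<in> Z"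
      using YZ unfolding star_def by blast
    obtain U where "U \<in> \<U>" "P \<union> Q \<subseteq> U" using W[of P Q] P Q by blast
    then show "x \<in> star Z \<U>" using P Q unfolding star_def by blast
  qed
  obtain K L where KL: "A \<in> hyper_ball T K \<W>" "B \<in> hyper_ball T K \<W>"
     "B \<in> hyper_ball T L \<W>" "C \<in> hyper_ball T L \<W>"
    using assms(2,3) unfolding hyper_entourage_def by blast
  then have "A \<in> hyper_ball T B \<U>" "C \<in> hyper_ball T B \<U>"
    unfolding hyper_ball_def using star by blast+
  moreover have "B \<in> hyperspace T" using KL unfolding hyper_ball_def by blast
  ultimately show ?thesis unfolding hyper_entourage_def by blast
qed

lemma diagonal_uniformity_hyperspace:
  assumes "admissible T \<O>" "\<O> \<noteq> {}"
  shows "diagonal_uniformity (hyperspace T) (hyperspace_uniformity T \<O>)"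
  unfolding diagonal_uniformity_def
proof (intro conjI allI impI ballI)
  have "hyper_entourage T \<U> \<subseteq> hyperspace T \<times> hyperspace T" for \<U>
    unfolding hyper_entourage_def hyper_ball_def by blast
  then have "\<forall>p\<in>hyper_entourage T \<U>. p \<in> hyperspace T \<times> hyperspace T" for \<U> by blast
  then show "hyperspace_uniformity T \<O> \<le> principal (hyperspace T \<times> hyperspace T)"
    unfolding le_principal eventually_hyperspace_uniformity[OF assms] using assms(2) by blast
next
  fix E assume E: "eventually E (hyperspace_uniformity T \<O>)"
  then obtain \<U> where U: "\<U> \<in> \<O>" "\<forall>p\<in>hyper_entourage T \<U>. E p"
    unfolding eventually_hyperspace_uniformity[OF assms] by blast
  show "E (A, A)" if "A \<in> hyperspace T" for A
    using hyper_entourage_refl[OF admissible_covering[OF assms(1) U(1)] that] U(2) by blast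
  have "\<forall>p\<in>hyper_entourage T \<U>. (\<lambda>(x, y). E (y, x)) p"
    using U(2) hyper_entourage_sym by blast
  then show "eventually (\<lambda>(x, y). E (y, x)) (hyperspace_uniformity T \<O>)"
    unfolding eventually_hyperspace_uniformity[OF assms] using U(1) by blast
  obtain \<W> where W: "\<W> \<in> \<O>" "\<And>A B. A \<in> \<W> \<Longrightarrow> B \<in> \<W> \<Longrightarrow> A \<inter> B \<noteq> {} \<Longrightarrow> \<exists>V\<in>\<U>. A \<union> B \<subseteq> V"
    using admissible_star_refinement[OF assms(1) U(1)] by metis
  let ?F = "\<lambda>p. p \<in> hyper_entourage T \<W>"
  have "eventually ?F (hyperspace_uniformity T \<O>)"
    unfolding eventually_hyperspace_uniformity[OF assms] using W(1) by blast
  moreover have "\<forall>x y z. ?F (x, y) \<longrightarrow> ?F (y, z) \<longrightarrow> E (x, z)"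
    using hyper_entourage_comp[OF W(2)] U(2) by blast
  ultimately show "\<exists>F. eventually F (hyperspace_uniformity T \<O>) \<and>
      (\<forall>x y z. F (x, y) \<longrightarrow> F (y, z) \<longrightarrow> E (x, z))" by blast
qed

lemma eventually_entourages_of_coverings:
  assumes "admissible T \<O>" "\<O> \<noteq> {}"
  shows "eventually P (entourages_of_coverings (covering_uniformity_with_base (topspace T) \<O>)) \<longleftrightarrow>
     (\<exists>\<U>\<in>\<O>. \<forall>U\<in>\<U>. \<forall>x\<in>U. \<forall>y\<in>U. P (x, y))"
proof -
  let ?C = "covering_uniformity_with_base (topspace T) \<O>"
  have sub: "\<O> \<subseteq> ?C"
  proof
    fix \<U> assume U: "\<U> \<in> \<O>"
    have "\<forall>U\<in>\<U>. \<exists>C\<in>\<U>. U \<subseteq> C" by blast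
    then show "\<U> \<in> ?C"
      using admissible_Union[OF assms(1) U] U unfolding covering_uniformity_with_base_def by simp blast
  qed
  have "\<exists>\<W>\<in>?C. principal (\<Union>C\<in>\<W>. C \<times> C) \<le>
      inf (principal (\<Union>C\<in>\<A>. C \<times> C)) (principal (\<Union>C\<in>\<B>. C \<times> C))"
    if AB: "\<A> \<in> ?C" "\<B> \<in> ?C" for \<A> \<B>
  proof -
    obtain \<U> \<V> where U: "\<U> \<in> \<O>" "\<forall>U\<in>\<U>. \<exists>C\<in>\<A>. U \<subseteq> C" and V: "\<V> \<in> \<O>" "\<forall>U\<in>\<V>. \<exists>C\<in>\<B>. U \<subseteq> C"
      using AB unfolding covering_uniformity_with_base_def by auto
    obtain \<W> where W: "\<W> \<in> \<O>" "\<And>A. A \<in> \<W> \<Longrightarrow> A \<noteq> {} \<Longrightarrow> \<exists>U\<in>\<U>. A \<subseteq> U"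
      "\<And>A. A \<in> \<W> \<Longrightarrow> A \<noteq> {} \<Longrightarrow> \<exists>V\<in>\<V>. A \<subseteq> V"
      using admissible_directed[OF assms(1) U(1) V(1)] by metis
    have "(\<Union>C\<in>\<W>. C \<times> C) \<subseteq> (\<Union>C\<in>\<A>. C \<times> C) \<inter> (\<Union>C\<in>\<B>. C \<times> C)"
    proof
      fix p assume "p \<in> (\<Union>C\<in>\<W>. C \<times> C)"
      then obtain C where C: "C \<in> \<W>" "p \<in> C \<times> C" by blast
      then obtain A B where "A \<in> \<A>" "B \<in> \<B>" "C \<subseteq> A" "C \<subseteq> B"
        using W(2,3)[of C] U(2) V(2) by (metis dual_order.trans empty_iff mem_Times_iff)
      then show "p \<in> (\<Union>C\<in>\<A>. C \<times> C) \<inter> (\<Union>C\<in>\<B>. C \<times> C)" using C by blast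
    qed
    then show ?thesis using W(1) sub by auto
  qed
  moreover have "?C \<noteq> {}" using sub assms(2) by blast
  ultimately have "eventually P (entourages_of_coverings ?C) \<longleftrightarrow>
     (\<exists>\<C>\<in>?C. \<forall>p\<in>(\<Union>C\<in>\<C>. C \<times> C). P p)"
    unfolding entourages_of_coverings_def
    by (subst eventually_INF_base) (auto simp: eventually_principal)
  also have "\<dots> \<longleftrightarrow> (\<exists>\<U>\<in>\<O>. \<forall>U\<in>\<U>. \<forall>x\<in>U. \<forall>y\<in>U. P (x, y))"
  proof
    assume "\<exists>\<C>\<in>?C. \<forall>p\<in>(\<Union>C\<in>\<C>. C \<times> C). P p"
    then obtain \<C> where C: "\<C> \<in> ?C" and P: "\<forall>p\<in>(\<Union>C\<in>\<C>. C \<times> C). P p" ..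
    obtain \<U> where U: "\<U> \<in> \<O>" "\<forall>U\<in>\<U>. \<exists>C\<in>\<C>. U \<subseteq> C"
      using C unfolding covering_uniformity_with_base_def by auto
    have "P (x, y)" if xy: "U \<in> \<U>" "x \<in> U" "y \<in> U" for U x y
    proof -
      obtain C where "C \<in> \<C>" "U \<subseteq> C" using U(2) xy(1) by auto
      then show ?thesis using P xy by auto
    qed
    then show "\<exists>\<U>\<in>\<O>. \<forall>U\<in>\<U>. \<forall>x\<in>U. \<forall>y\<in>U. P (x, y)" using U(1) by auto
  next
    assume "\<exists>\<U>\<in>\<O>. \<forall>U\<in>\<U>. \<forall>x\<in>U. \<forall>y\<in>U. P (x, y)"
    then obtain \<U> where U: "\<U> \<in> \<O>" "\<forall>U\<in>\<U>. \<forall>x\<in>U. \<forall>y\<in>U. P (x, y)" ..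
    show "\<exists>\<C>\<in>?C. \<forall>p\<in>(\<Union>C\<in>\<C>. C \<times> C). P p"
    proof
      show "\<U> \<in> ?C" using sub U(1) by (rule subsetD)
      show "\<forall>p\<in>(\<Union>C\<in>\<U>. C \<times> C). P p" using U(2) by auto
    qed
  qed
  finally show ?thesis .
qed

lemma diagonal_uniformity_coverings:
  assumes "admissible T \<O>" "\<O> \<noteq> {}"
  shows "diagonal_uniformity (topspace T)
    (entourages_of_coverings (covering_uniformity_with_base (topspace T) \<O>))"
    (is "diagonal_uniformity _ ?D")
  unfolding diagonal_uniformity_def
proof (intro conjI allI impI ballI)
  show "?D \<le> principal (topspace T \<times> topspace T)"
    unfolding le_principal eventually_entourages_of_coverings[OF assms]
  proof -
    obtain \<U> where U: "\<U> \<in> \<O>" using assms(2) by blast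
    have "\<forall>U\<in>\<U>. \<forall>x\<in>U. \<forall>y\<in>U. (x, y) \<in> topspace T \<times> topspace T"
      unfolding admissible_Union[OF assms(1) U, symmetric] by blast
    then show "\<exists>\<U>\<in>\<O>. \<forall>U\<in>\<U>. \<forall>x\<in>U. \<forall>y\<in>U. (x, y) \<in> topspace T \<times> topspace T"
      using U by blast
  qed
next
  fix E assume "eventually E ?D"
  then obtain \<U> where U: "\<U> \<in> \<O>" "\<And>U x y. U\<in>\<U> \<Longrightarrow> x\<in>U \<Longrightarrow> y\<in>U \<Longrightarrow> E (x, y)"
    unfolding eventually_entourages_of_coverings[OF assms] by blast
  show "E (x, x)" if "x \<in> topspace T" for x
  proof -
    have "x \<in> \<Union>\<U>" using that admissible_Union[OF assms(1) U(1)] by simp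
    then show ?thesis using U(2) by blast
  qed
  show "eventually (\<lambda>(x, y). E (y, x)) ?D"
    unfolding eventually_entourages_of_coverings[OF assms] using U by (intro bexI[of _ \<U>]) auto
  obtain \<W> where W: "\<W> \<in> \<O>" "\<And>A B. A \<in> \<W> \<Longrightarrow> B \<in> \<W> \<Longrightarrow> A \<inter> B \<noteq> {} \<Longrightarrow> \<exists>V\<in>\<U>. A \<union> B \<subseteq> V"
    using admissible_star_refinement[OF assms(1) U(1)] by metis
  let ?F = "\<lambda>p. \<exists>A\<in>\<W>. p \<in> A \<times> A"
  have "eventually ?F ?D"
    unfolding eventually_entourages_of_coverings[OF assms] using W(1) by blast
  moreover have "E (x, z)" if "?F (x, y)" "?F (y, z)" for x y z
  proof -
    obtain A B where AB: "A \<in> \<W>" "B \<in> \<W>" "x \<in> A" "y \<in> A" "y \<in> B" "z \<in> B" using \<open>?F (x, y)\<close> \<open>?F (y, z)\<close> by blast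
    then obtain V where "V \<in> \<U>" "A \<union> B \<subseteq> V" using W(2)[of A B] by blast
    then show ?thesis using U(2)[of V x z] AB by blast
  qed
  ultimately show "\<exists>F. eventually F ?D \<and> (\<forall>x y z. F (x, y) \<longrightarrow> F (y, z) \<longrightarrow> E (x, z))" by blast
qed

context topological_group
begin

lemma continuous_left: "a \<in> carrier G \<Longrightarrow> continuous_map T T (\<lambda>x. a \<otimes> x)"
  using continuous_map_compose[OF _ continuous_mult, of T "\<lambda>x. (a, x)"]
  by (simp add: o_def continuous_map_pairwise topspace_eq)

lemma continuous_right: "a \<in> carrier G \<Longrightarrow> continuous_map T T (\<lambda>x. x \<otimes> a)"
  using continuous_map_compose[OF _ continuous_mult, of T "\<lambda>x. (x, a)"]
  by (simp add: o_def continuous_map_pairwise topspace_eq)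

lemma closedin_l_coset:
  assumes "closedin T A" "a \<in> carrier G" shows "closedin T (a <# A)"
proof -
  have A: "A \<subseteq> carrier G" using closedin_subset[OF assms(1)] topspace_eq by simp
  have "{x \<in> topspace T. inv a \<otimes> x \<in> A} = a <# A" (is "?L = ?R")
  proof
    show "?L \<subseteq> ?R"
    proof
      fix x assume "x \<in> ?L"
      then have "x = a \<otimes> (inv a \<otimes> x)" "inv a \<otimes> x \<in> A"
        using assms(2) by (auto simp: topspace_eq m_assoc[symmetric])
      then show "x \<in> ?R" unfolding l_coset_def by blast
    qed
    show "?R \<subseteq> ?L"
      using A assms(2) by (auto simp: l_coset_def topspace_eq m_assoc[symmetric] subset_iff)
  qed
  then show ?thesis
    using closedin_continuous_map_preimage[OF continuous_left assms(1), of "inv a"] assms(2) by simp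
qed

lemma lcosets_subset_hyperspace:
  assumes "subgroup S G" "closedin T S" shows "lcosets S \<subseteq> hyperspace T"
  using closedin_l_coset[OF assms(2)] subgroup.one_closed[OF assms(1)]
  by (fastforce simp: LCOSETS_def hyperspace_def l_coset_def)

lemma openin_r_coset:
  assumes "openin T A" "a \<in> carrier G" shows "openin T (A #> a)"
proof -
  have A: "A \<subseteq> carrier G" using openin_subset[OF assms(1)] topspace_eq by simp
  have "{x \<in> topspace T. x \<otimes> inv a \<in> A} = A #> a" (is "?L = ?R")
  proof
    show "?L \<subseteq> ?R"
    proof
      fix x assume "x \<in> ?L"
      then have "x = x \<otimes> inv a \<otimes> a" "x \<otimes> inv a \<in> A"
        using assms(2) by (auto simp: topspace_eq m_assoc)
      then show "x \<in> ?R" unfolding r_coset_def by blast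
    qed
    show "?R \<subseteq> ?L"
      using A assms(2) by (auto simp: r_coset_def topspace_eq m_assoc subset_iff)
  qed
  then show ?thesis
    using openin_continuous_map_preimage[OF continuous_right assms(1), of "inv a"] assms(2) by simp
qed

lemma star_translates:
  assumes "V \<subseteq> carrier G" "set_inv V = V" "g \<in> carrier G"
  shows "star {g} (rcosets V) = (V <#> V) #> g"
proof
  show "star {g} (rcosets V) \<subseteq> (V <#> V) #> g"
  proof
    fix x assume "x \<in> star {g} (rcosets V)"
    then obtain h u v where h: "h \<in> carrier G" "u \<in> V" "v \<in> V" "g = u \<otimes> h" "x = v \<otimes> h"
      unfolding star_def RCOSETS_def r_coset_def by blast
    then have "x = v \<otimes> inv u \<otimes> g"
      using assms(1) by (simp add: subset_iff m_assoc inv_solve_left)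
    moreover have "inv u \<in> V" using assms(2) h(2) unfolding SET_INV_def by blast
    ultimately show "x \<in> (V <#> V) #> g" using h unfolding set_mult_def r_coset_def by blast
  qed
  show "(V <#> V) #> g \<subseteq> star {g} (rcosets V)"
  proof
    fix x assume "x \<in> (V <#> V) #> g"
    then obtain u v where h: "u \<in> V" "v \<in> V" "x = u \<otimes> v \<otimes> g"
      unfolding set_mult_def r_coset_def by blast
    have c: "u \<in> carrier G" "v \<in> carrier G" using h assms(1) by auto
    have "inv v \<in> V" using assms(2) h(2) unfolding SET_INV_def by blast
    moreover have "g = inv v \<otimes> (v \<otimes> g)" "x = u \<otimes> (v \<otimes> g)" "v \<otimes> g \<in> carrier G"
      using c h assms(3) by (auto simp: m_assoc[symmetric])
    ultimately show "x \<in> star {g} (rcosets V)"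
      using h unfolding star_def RCOSETS_def r_coset_def by blast
  qed
qed

lemma symmetric_nhd_basisD:
  assumes "symmetric_nhd_basis G T \<V>" "V \<in> \<V>"
  shows "openin T V" "\<one> \<in> V" "set_inv V = V" "V \<subseteq> carrier G" "x \<in> V \<Longrightarrow> inv x \<in> V"
proof -
  show V: "openin T V" "\<one> \<in> V" "set_inv V = V"
    using assms unfolding symmetric_nhd_basis_def by auto
  show "V \<subseteq> carrier G" using openin_subset[OF V(1)] topspace_eq by simp
  show "inv x \<in> V" if "x \<in> V"
  proof -
    have "inv x \<in> set_inv V" using that unfolding SET_INV_def by auto
    then show ?thesis using V(3) by simp
  qed
qed

lemma symmetric_nhd_basis_small:
  assumes "symmetric_nhd_basis G T \<V>" "openin T W" "\<one> \<in> W"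
  obtains V where "V \<in> \<V>" "V \<subseteq> W"
  using assms unfolding symmetric_nhd_basis_def by auto

lemma small_square:
  assumes "symmetric_nhd_basis G T \<V>" "openin T W" "\<one> \<in> W"
  obtains V where "V \<in> \<V>" "V <#> V \<subseteq> W"
proof -
  have "openin (prod_topology T T) {p \<in> topspace (prod_topology T T). (\<lambda>(x, y). x \<otimes> y) p \<in> W}"
    by (rule openin_continuous_map_preimage[OF continuous_mult assms(2)])
  moreover have "(\<one>, \<one>) \<in> {p \<in> topspace (prod_topology T T). (\<lambda>(x, y). x \<otimes> y) p \<in> W}"
    using assms(3) by (simp add: topspace_eq)
  ultimately obtain A B where AB: "openin T A" "openin T B" "\<one> \<in> A" "\<one> \<in> B"
    "A \<times> B \<subseteq> {p \<in> topspace (prod_topology T T). (\<lambda>(x, y). x \<otimes> y) p \<in> W}"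
    unfolding openin_prod_topology_alt by meson
  then have "openin T (A \<inter> B)" "\<one> \<in> A \<inter> B" by auto
  then obtain V where V: "V \<in> \<V>" "V \<subseteq> A \<inter> B"
    using assms(1) unfolding symmetric_nhd_basis_def by blast
  have "u \<otimes> v \<in> W" if uv: "u \<in> V" "v \<in> V" for u v
  proof -
    have "(u, v) \<in> A \<times> B" using uv V(2) by auto
    then show ?thesis using AB(5) by auto
  qed
  then have "V <#> V \<subseteq> W" unfolding set_mult_def by auto
  then show ?thesis using that V(1) by simp
qed

lemma small_cube:
  assumes "symmetric_nhd_basis G T \<V>" "openin T W" "\<one> \<in> W"
  obtains V where "V \<in> \<V>" "V <#> V <#> V \<subseteq> W"
proof -
  obtain U where U: "U \<in> \<V>" "U <#> U \<subseteq> W" using small_square[OF assms] .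
  then have "openin T U" "\<one> \<in> U" using assms(1) unfolding symmetric_nhd_basis_def by auto
  then obtain V where V: "V \<in> \<V>" "V <#> V \<subseteq> U" using small_square[OF assms(1)] by metis
  have "openin T V" "\<one> \<in> V" using V assms(1) unfolding symmetric_nhd_basis_def by auto
  then have "x \<in> V <#> V" if "x \<in> V" for x
  proof -
    have "x = x \<otimes> \<one>" using openin_subset[OF \<open>openin T V\<close>] that topspace_eq by auto
    then show ?thesis using that \<open>\<one> \<in> V\<close> unfolding set_mult_def by blast
  qed
  then have "V \<subseteq> V <#> V" by blast
  then have "V <#> V <#> V \<subseteq> U <#> U" using V mono_set_mult by blast
  then show ?thesis using that V U by blast
qed

lemma translate_coverings_nonempty:
  assumes "symmetric_nhd_basis G T \<V>" shows "translate_coverings G \<V> \<noteq> {}"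
proof -
  have "openin T (topspace T)" by simp
  moreover have "\<one> \<in> topspace T" by (simp add: topspace_eq)
  ultimately have "\<V> \<noteq> {}" using assms unfolding symmetric_nhd_basis_def by blast
  then show ?thesis unfolding translate_coverings_def by blast
qed

lemma admissible_translate_coverings:
  assumes "symmetric_nhd_basis G T \<V>"
  shows "admissible T (translate_coverings G \<V>)"
proof -
  have V: "openin T V" "\<one> \<in> V" "set_inv V = V" "V \<subseteq> carrier G" if "V \<in> \<V>" for V
    using symmetric_nhd_basisD[OF assms that] by simp_all
  have cov: "open_covering T (rcosets V)" if "V \<in> \<V>" for V
    unfolding open_covering_def
  proof
    show op: "\<forall>U\<in>rcosets V. openin T U"
      using openin_r_coset[OF V(1)[OF that]] unfolding RCOSETS_def by auto
    have "x \<in> \<Union>(rcosets V)" if x: "x \<in> carrier G" for x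
    proof -
      have "x = \<one> \<otimes> x" using x by simp
      then have "x \<in> V #> x" using V(2)[OF \<open>V \<in> \<V>\<close>] unfolding r_coset_def by blast
      then show ?thesis using x unfolding RCOSETS_def by blast
    qed
    moreover have "\<Union>(rcosets V) \<subseteq> topspace T" using op openin_subset by (intro Union_least) auto
    ultimately show "\<Union>(rcosets V) = topspace T" unfolding topspace_eq by auto
  qed
  have union: "\<exists>C\<in>rcosets U. A \<union> B \<subseteq> C"
    if W: "W \<in> \<V>" "W <#> W <#> W \<subseteq> U" and AB: "A \<in> rcosets W" "B \<in> rcosets W" "A \<inter> B \<noteq> {}"
    for U W A B
  proof -
    obtain a b where ab: "a \<in> carrier G" "b \<in> carrier G" "A = W #> a" "B = W #> b"
      using AB unfolding RCOSETS_def by blast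
    then obtain u v where uv: "u \<in> W" "v \<in> W" "u \<otimes> a = v \<otimes> b"
      using AB(3) unfolding r_coset_def by blast
    note c = V(4)[OF W(1), THEN subsetD]
    have inv: "inv x \<in> W" if "x \<in> W" for x using symmetric_nhd_basisD(5)[OF assms W(1) that] .
    have mem: "x \<otimes> y \<otimes> z \<in> U" if "x \<in> W" "y \<in> W" "z \<in> W" for x y z
    proof -
      have "x \<otimes> y \<otimes> z \<in> W <#> W <#> W" using that unfolding set_mult_def by blast
      then show ?thesis using W(2) by auto
    qed
    have b: "b = inv v \<otimes> u \<otimes> a"
    proof -
      have "u \<in> carrier G" "v \<in> carrier G" using uv c by auto
      then have "inv v \<otimes> u \<otimes> a = inv v \<otimes> (v \<otimes> b)" using ab uv(3) by (simp add: m_assoc)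
      also have "\<dots> = b" using \<open>v \<in> carrier G\<close> ab by (simp add: m_assoc[symmetric])
      finally show ?thesis by simp
    qed
    have "A \<union> B \<subseteq> U #> a"
    proof
      fix x assume "x \<in> A \<union> B"
      then consider w where "w \<in> W" "x = w \<otimes> a" | w where "w \<in> W" "x = w \<otimes> b"
        unfolding ab r_coset_def by blast
      then show "x \<in> U #> a"
      proof cases
        case 1
        have "w \<otimes> \<one> \<otimes> \<one> \<in> U" using mem V(2)[OF W(1)] 1 by simp
        then have "w \<in> U" using c[OF 1(1)] by simp
        then show ?thesis using 1 unfolding r_coset_def by blast
      next
        case 2
        have "x = w \<otimes> inv v \<otimes> u \<otimes> a"
          using 2(2) c[OF 2(1)] c[OF uv(1)] c[OF uv(2)] ab(1) unfolding b by (simp add: m_assoc)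
        moreover have "w \<otimes> inv v \<otimes> u \<in> U" using mem[OF 2(1) inv[OF uv(2)] uv(1)] .
        ultimately show ?thesis unfolding r_coset_def by blast
      qed
    qed
    then show ?thesis using ab(1) unfolding RCOSETS_def by blast
  qed
  have dir: "\<exists>W\<in>\<V>. \<forall>A\<in>rcosets W. \<forall>B\<in>rcosets W. A \<inter> B \<noteq> {} \<longrightarrow>
        (\<exists>U\<in>rcosets U. A \<union> B \<subseteq> U) \<and> (\<exists>V\<in>rcosets V. A \<union> B \<subseteq> V)" if "U \<in> \<V>" "V \<in> \<V>" for U V
  proof -
    have "openin T (U \<inter> V)" "\<one> \<in> U \<inter> V" using V that by auto
    then obtain W where W: "W \<in> \<V>" "W <#> W <#> W \<subseteq> U \<inter> V" by (rule small_cube[OF assms])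
    then have "W <#> W <#> W \<subseteq> U" "W <#> W <#> W \<subseteq> V" by simp_all
    note u = union[OF W(1) this(1)] union[OF W(1) this(2)]
    show ?thesis
    proof (rule bexI[of _ W], intro ballI impI conjI)
      fix A B assume "A \<in> rcosets W" "B \<in> rcosets W" "A \<inter> B \<noteq> {}"
      then show "\<exists>U\<in>rcosets U. A \<union> B \<subseteq> U" "\<exists>V\<in>rcosets V. A \<union> B \<subseteq> V"
        using u by simp_all
    qed (rule W(1))
  qed
  have op: "openin T (star Y (rcosets V))" if "V \<in> \<V>" for Y V
    using cov[OF that] unfolding star_def open_covering_def by (intro openin_Union) simp
  have basis: "\<exists>V\<in>\<V>. x \<in> star {x} (rcosets V) \<and> star {x} (rcosets V) \<subseteq> W"
    if "openin T W" "x \<in> W" for W x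
  proof -
    have WG: "W \<subseteq> carrier G" using openin_subset[OF that(1)] topspace_eq by simp
    have x: "x \<in> carrier G" using WG that(2) by auto
    have "openin T (W #> inv x)" using openin_r_coset[OF that(1)] x by simp
    moreover have "\<one> \<in> W #> inv x" using that(2) r_inv[OF x, symmetric] unfolding r_coset_def by blast
    ultimately obtain V where V': "V \<in> \<V>" "V <#> V \<subseteq> W #> inv x" by (rule small_square[OF assms])
    have "(V <#> V) #> x \<subseteq> (W #> inv x) #> x" using V'(2) unfolding r_coset_def by blast
    also have "\<dots> = W" using coset_mult_assoc[OF WG, of "inv x" x] x WG by simp
    finally have "star {x} (rcosets V) \<subseteq> W" using star_translates[OF V(4,3)[OF V'(1)] x] by simp
    moreover have "x \<in> star {x} (rcosets V)"
      using star_covering[of "{x}" "rcosets V"] cov[OF V'(1)] x topspace_eq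
      unfolding open_covering_def by simp
    ultimately show ?thesis using V' by blast
  qed
  show ?thesis
    unfolding admissible_def translate_coverings_def
  proof (intro conjI ballI allI impI; (elim conjE CollectE exE)?; (simp only:)?)
    show "open_covering T (rcosets V)" if "V \<in> \<V>" for V using cov[OF that] .
    fix U V assume UV: "U \<in> \<V>" "V \<in> \<V>"
    obtain W where W: "W \<in> \<V>" "\<forall>A\<in>rcosets W. \<forall>B\<in>rcosets W. A \<inter> B \<noteq> {} \<longrightarrow>
        (\<exists>U\<in>rcosets U. A \<union> B \<subseteq> U) \<and> (\<exists>V\<in>rcosets V. A \<union> B \<subseteq> V)"
      using dir[OF UV] by (elim bexE)
    show "\<exists>\<W>\<in>{rcosets V |V. V \<in> \<V>}. \<forall>A\<in>\<W>. \<forall>B\<in>\<W>. A \<inter> B \<noteq> {} \<longrightarrow>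
        (\<exists>U\<in>rcosets U. A \<union> B \<subseteq> U) \<and> (\<exists>V\<in>rcosets V. A \<union> B \<subseteq> V)"
      by (rule bexI[of _ "rcosets W"], rule W(2)) (use W(1) in blast)
  next
    show "openin T (star {x} (rcosets V))" if "V \<in> \<V>" for x V using op[OF that] .
  next
    fix W x assume Wx: "openin T W" "x \<in> W"
    obtain V where V': "V \<in> \<V>" "x \<in> star {x} (rcosets V)" "star {x} (rcosets V) \<subseteq> W"
      using basis[OF Wx] by blast
    have "x \<in> topspace T" using openin_subset[OF Wx(1)] Wx(2) by auto
    then show "\<exists>\<U>\<in>{rcosets V |V. V \<in> \<V>}. \<exists>y\<in>topspace T. x \<in> star {y} \<U> \<and> star {y} \<U> \<subseteq> W"
      using V' by (intro bexI[of _ "rcosets V"] bexI[of _ x] conjI) auto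
  qed
qed

end

end

theory Submission
  imports Defs
begin

text \<open>
  Right multiplication by an element of \<open>S\<close> maps each right translate \<open>V #> g\<close> onto a
  right translate of \<open>V\<close> and maps each left coset of \<open>S\<close> to itself. Hence if two points lie in
  one member of \<open>rcosets V\<close>, then so do their translates by any \<open>s \<in> S\<close>, and the cosets of the
  two points are close to each other in the sense of \<open>hyper_entourage\<close> for the same covering
  (\<open>l_cosets_close\<close>). This is the uniform continuity of the projection, and, as the translates
  \<open>V #> g\<close> are neighborhoods of \<open>g\<close>, also its continuity: sets that are open in the uniform
  topology are open in the quotient topology.

  Conversely, let the union of a set \<open>\<Q>\<close> of cosets be open, and let \<open>g\<close> be a point of it. Some star
  of \<open>g\<close> with respect to a covering \<open>\<U>\<close> is contained in this union (\<open>translate_stars_centred\<close>). If a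
  coset \<open>B\<close> is close to \<open>g <# S\<close> with respect to a covering in which the union of
  any two intersecting members lies in a member of \<open>\<U>\<close>, then \<open>B\<close> meets the star of \<open>g\<close>
  (\<open>hyper_entourage_imp_star\<close>). A coset that meets the union of \<open>\<Q>\<close> belongs to
  \<open>\<Q>\<close>, so \<open>\<Q>\<close> contains all cosets close to \<open>g <# S\<close> and is open in the uniform topology.
\<close>

text \<open>
  Two sets that are close in the hyperspace need only be comparable to a common third set, so
  passing from one to the other takes two steps in the covering \<open>\<W>\<close>. This is why a refinement is
  needed.
\<close>

lemma hyper_entourage_imp_star:
  assumes "\<And>P Q. P \<in> \<W> \<Longrightarrow> Q \<in> \<W> \<Longrightarrow> P \<inter> Q \<noteq> {} \<Longrightarrow> \<exists>U\<in>\<U>. P \<union> Q \<subseteq> U"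
    and "(A, B) \<in> hyper_entourage T \<W>"
  shows "A \<subseteq> star B \<U>"
proof
  fix x assume "x \<in> A"
  obtain C where C: "A \<subseteq> star C \<W>" "C \<subseteq> star B \<W>"
    using assms(2) unfolding hyper_entourage_def hyper_ball_def by blast
  obtain P c where P: "P \<in> \<W>" "x \<in> P" "c \<in> P" "c \<in> C"
    using C(1) \<open>x \<in> A\<close> unfolding star_def by blast
  obtain Q b where Q: "Q \<in> \<W>" "c \<in> Q" "b \<in> Q" "b \<in> B"
    using C(2) P(4) unfolding star_def by blast
  obtain U where "U \<in> \<U>" "P \<union> Q \<subseteq> U" using assms(1)[of P Q] P Q by blast
  then show "x \<in> star B \<U>" using P Q unfolding star_def by blast
qed

context topological_group
begin

text \<open>
  Admissibility provides, around a point \<open>x\<close> of an open set, stars whose center may differ from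
  \<open>x\<close>. In a group the center can be taken to be \<open>x\<close>, because the star of \<open>x\<close> is
  \<open>(V <#> V) #> x\<close>.
\<close>

lemma translate_stars_centred:
  assumes "symmetric_nhd_basis G T \<V>" "openin T W" "x \<in> W"
  obtains V where "V \<in> \<V>" "star {x} (rcosets V) \<subseteq> W"
proof -
  have WG: "W \<subseteq> carrier G" using openin_subset[OF assms(2)] topspace_eq by simp
  then have x: "x \<in> carrier G" using assms(3) by auto
  have "openin T (W #> inv x)" using openin_r_coset[OF assms(2)] x by simp
  moreover have "\<one> \<in> W #> inv x"
    using assms(3) r_inv[OF x, symmetric] unfolding r_coset_def by blast
  ultimately obtain V where V: "V \<in> \<V>" "V <#> V \<subseteq> W #> inv x"
    by (rule small_square[OF assms(1)])
  have "star {x} (rcosets V) = (V <#> V) #> x"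
    using star_translates symmetric_nhd_basisD(3,4)[OF assms(1) V(1)] x by simp
  also have "\<dots> \<subseteq> (W #> inv x) #> x" using V(2) unfolding r_coset_def by blast
  also have "\<dots> = W" using coset_mult_assoc[OF WG, of "inv x" x] x WG by simp
  finally show ?thesis using that V(1) by simp
qed

text \<open>
  Write \<open>U = V #> g\<close>. For \<open>s \<in> S\<close>, both \<open>x \<otimes> s\<close> and \<open>y \<otimes> s\<close> lie in \<open>U #> s\<close>, which is the
  member \<open>V #> (g \<otimes> s)\<close> of the same covering. So no finer covering is needed for the cosets than
  for the points.
\<close>

lemma l_cosets_close:
  assumes "subgroup S G" "closedin T S" "open_covering T (rcosets V)" "V \<subseteq> carrier G"
    and "U \<in> rcosets V" "x \<in> U" "y \<in> U"
  shows "(x <# S, y <# S) \<in> hyper_entourage T (rcosets V)"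
proof -
  obtain g u v where g: "g \<in> carrier G" "u \<in> V" "v \<in> V" "x = u \<otimes> g" "y = v \<otimes> g"
    using assms(5-7) unfolding RCOSETS_def r_coset_def by blast
  then have "x \<in> carrier G" "y \<in> carrier G" using assms(4) by auto
  then have hyp: "x <# S \<in> hyperspace T" "y <# S \<in> hyperspace T"
    using lcosets_subset_hyperspace[OF assms(1,2)] unfolding LCOSETS_def by auto
  have star: "(a \<otimes> g) <# S \<subseteq> star ((b \<otimes> g) <# S) (rcosets V)" if "a \<in> V" "b \<in> V" for a b
  proof
    fix z assume "z \<in> (a \<otimes> g) <# S"
    then obtain s where s: "s \<in> S" "z = a \<otimes> g \<otimes> s" unfolding l_coset_def by blast
    have sG: "s \<in> carrier G" using subgroup.mem_carrier[OF assms(1) s(1)] .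
    have "z = a \<otimes> (g \<otimes> s)" "b \<otimes> g \<otimes> s = b \<otimes> (g \<otimes> s)"
      using that assms(4) g(1) sG s(2) by (auto simp: m_assoc)
    then have "z \<in> V #> (g \<otimes> s)" "b \<otimes> g \<otimes> s \<in> V #> (g \<otimes> s)"
      using that unfolding r_coset_def by blast+
    moreover have "b \<otimes> g \<otimes> s \<in> (b \<otimes> g) <# S" using s(1) unfolding l_coset_def by blast
    moreover have "V #> (g \<otimes> s) \<in> rcosets V" using g(1) sG unfolding RCOSETS_def by blast
    ultimately show "z \<in> star ((b \<otimes> g) <# S) (rcosets V)" unfolding star_def by blast
  qed
  have "y <# S \<in> hyper_ball T (x <# S) (rcosets V)"
    using star g hyp unfolding hyper_ball_def by simp
  moreover have "x <# S \<in> hyper_ball T (x <# S) (rcosets V)"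
    using star g hyp unfolding hyper_ball_def by simp
  ultimately show ?thesis using hyp(1) unfolding hyper_entourage_def by blast
qed

lemma eventually_lcosets_uniformity:
  assumes "symmetric_nhd_basis G T \<V>"
  shows "eventually P (subspace_uniformity (hyperspace_uniformity T (translate_coverings G \<V>)) (lcosets S))
    \<longleftrightarrow> (\<exists>V\<in>\<V>. \<forall>A\<in>lcosets S. \<forall>B\<in>lcosets S.
          (A, B) \<in> hyper_entourage T (rcosets V) \<longrightarrow> P (A, B))"
  unfolding subspace_uniformity_def eventually_inf_principal
    eventually_hyperspace_uniformity[OF admissible_translate_coverings[OF assms]
      translate_coverings_nonempty[OF assms]]
  unfolding translate_coverings_def by blast

lemma uniformly_continuous_l_coset:
  assumes "subgroup S G" "closedin T S" "symmetric_nhd_basis G T \<V>"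
  shows "uniformly_continuous_between (carrier G)
           (entourages_of_coverings
              (covering_uniformity_with_base (carrier G) (translate_coverings G \<V>)))
           (lcosets S)
           (subspace_uniformity (hyperspace_uniformity T (translate_coverings G \<V>)) (lcosets S))
           (\<lambda>g. g <# S)"
  unfolding uniformly_continuous_between_def filterlim_iff
proof (intro conjI allI impI)
  show "(\<lambda>g. g <# S) ` carrier G \<subseteq> lcosets S" unfolding LCOSETS_def by blast
next
  note adm = admissible_translate_coverings[OF assms(3)]
  fix P assume "eventually P
    (subspace_uniformity (hyperspace_uniformity T (translate_coverings G \<V>)) (lcosets S))"
  then obtain V where V: "V \<in> \<V>" and P: "\<And>A B. A \<in> lcosets S \<Longrightarrow> B \<in> lcosets S \<Longrightarrow>
      (A, B) \<in> hyper_entourage T (rcosets V) \<Longrightarrow> P (A, B)"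
    unfolding eventually_lcosets_uniformity[OF assms(3)] by blast
  have mem: "rcosets V \<in> translate_coverings G \<V>" using V unfolding translate_coverings_def by blast
  have cov: "open_covering T (rcosets V)" using admissible_covering[OF adm mem] .
  have "P (x <# S, y <# S)" if "U \<in> rcosets V" "x \<in> U" "y \<in> U" for U x y
  proof (rule P)
    have "x \<in> carrier G" "y \<in> carrier G"
      using that cov unfolding open_covering_def topspace_eq by blast+
    then show "x <# S \<in> lcosets S" "y <# S \<in> lcosets S" unfolding LCOSETS_def by blast+
    show "(x <# S, y <# S) \<in> hyper_entourage T (rcosets V)"
      using l_cosets_close[OF assms(1,2) cov symmetric_nhd_basisD(4)[OF assms(3) V] that] .
  qed
  then show "eventually (\<lambda>p. P ((\<lambda>(x, y). (x <# S, y <# S)) p)) (entourages_of_coverings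
       (covering_uniformity_with_base (carrier G) (translate_coverings G \<V>)))"
    unfolding topspace_eq[symmetric]
      eventually_entourages_of_coverings[OF adm translate_coverings_nonempty[OF assms(3)]]
    using mem by auto
qed

lemma quotient_topology_eq_uniform_topology:
  assumes "subgroup S G" "closedin T S" "symmetric_nhd_basis G T \<V>"
  shows "quotient_topology T (\<lambda>g. g <# S) =
    uniform_topology (lcosets S)
      (subspace_uniformity (hyperspace_uniformity T (translate_coverings G \<V>)) (lcosets S))"
  unfolding topology_eq openin_quotient_topology openin_uniform_topology
    eventually_lcosets_uniformity[OF assms(3)]
proof (intro allI, rule conj_cong)
  fix \<Q> :: "'a set set"
  show "\<Q> \<subseteq> (\<lambda>g. g <# S) ` topspace T \<longleftrightarrow> \<Q> \<subseteq> lcosets S"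
    unfolding LCOSETS_def topspace_eq by auto
next
  fix \<Q> :: "'a set set" assume Q: "\<Q> \<subseteq> lcosets S"
  define W where "W = {g \<in> topspace T. g <# S \<in> \<Q>}"
  note adm = admissible_translate_coverings[OF assms(3)]
  have mem: "rcosets V \<in> translate_coverings G \<V>" if "V \<in> \<V>" for V
    using that unfolding translate_coverings_def by blast
  show "openin T {g \<in> topspace T. g <# S \<in> \<Q>} \<longleftrightarrow>
    (\<forall>A\<in>\<Q>. \<exists>V\<in>\<V>. \<forall>A'\<in>lcosets S. \<forall>B\<in>lcosets S. (A', B) \<in> hyper_entourage T (rcosets V) \<longrightarrow>
        (case (A', B) of (x', y) \<Rightarrow> x' = A \<longrightarrow> y \<in> \<Q>))"
    unfolding W_def[symmetric]
  proof (intro iffI ballI)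
    fix A assume W: "openin T W" and A: "A \<in> \<Q>"
    obtain g where g: "g \<in> carrier G" "A = g <# S" using A Q unfolding LCOSETS_def by blast
    then have "g \<in> W" using A unfolding W_def topspace_eq by simp
    then obtain U where U: "U \<in> \<V>" "star {g} (rcosets U) \<subseteq> W"
      by (rule translate_stars_centred[OF assms(3) W])
    obtain \<W> where \<W>: "\<W> \<in> translate_coverings G \<V>"
      "\<And>P Q. P \<in> \<W> \<Longrightarrow> Q \<in> \<W> \<Longrightarrow> P \<inter> Q \<noteq> {} \<Longrightarrow> \<exists>C\<in>rcosets U. P \<union> Q \<subseteq> C"
      using admissible_star_refinement[OF adm mem[OF U(1)]] by metis
    obtain V where V: "V \<in> \<V>" "\<W> = rcosets V" using \<W>(1) unfolding translate_coverings_def by blast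
    have "B \<in> \<Q>" if B: "B \<in> lcosets S" "(A, B) \<in> hyper_entourage T (rcosets V)" for B
    proof -
      have "g \<in> A"
        unfolding g(2) using lcos_self[OF g(1) assms(1)] .
      then have "g \<in> star B (rcosets U)"
        using hyper_entourage_imp_star[OF \<W>(2)] B(2) V(2) by blast
      then obtain y where y: "y \<in> B" "y \<in> star {g} (rcosets U)" unfolding star_def by blast
      then have "y <# S \<in> \<Q>" using U(2) unfolding W_def by blast
      moreover obtain h where h: "h \<in> carrier G" "B = h <# S"
        using B(1) unfolding LCOSETS_def by blast
      \<comment> \<open>\<open>B\<close> and \<open>y <# S\<close> are cosets with the common point \<open>y\<close>, hence equal.\<close>
      ultimately show "B \<in> \<Q>" using l_repr_independence[OF _ h(1) assms(1)] y(1) by simp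
    qed
    then show "\<exists>V\<in>\<V>. \<forall>A'\<in>lcosets S. \<forall>B\<in>lcosets S. (A', B) \<in> hyper_entourage T (rcosets V) \<longrightarrow>
        (case (A', B) of (x', y) \<Rightarrow> x' = A \<longrightarrow> y \<in> \<Q>)"
      using V(1) by auto
  next
    assume unif: "\<forall>A\<in>\<Q>. \<exists>V\<in>\<V>. \<forall>A'\<in>lcosets S. \<forall>B\<in>lcosets S.
      (A', B) \<in> hyper_entourage T (rcosets V) \<longrightarrow> (case (A', B) of (x', y) \<Rightarrow> x' = A \<longrightarrow> y \<in> \<Q>)"
    show "openin T W"
    proof (subst openin_subopen, intro ballI)
      fix g assume "g \<in> W"
      then have g: "g \<in> carrier G" "g <# S \<in> \<Q>" unfolding W_def topspace_eq by simp_all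
      then obtain V where V: "V \<in> \<V>" and near: "\<And>B. B \<in> lcosets S \<Longrightarrow>
          (g <# S, B) \<in> hyper_entourage T (rcosets V) \<Longrightarrow> B \<in> \<Q>"
        using unif Q by fastforce
      note V' = symmetric_nhd_basisD[OF assms(3) V]
      have cov: "open_covering T (rcosets V)" using admissible_covering[OF adm mem[OF V]] .
      have Vg: "V #> g \<in> rcosets V" using g(1) unfolding RCOSETS_def by blast
      have open_Vg: "openin T (V #> g)" using openin_r_coset[OF V'(1) g(1)] .
      have gV: "g \<in> V #> g" using V'(2) l_one[OF g(1), symmetric] unfolding r_coset_def by blast
      have "x \<in> W" if x: "x \<in> V #> g" for x
      proof -
        have xG: "x \<in> carrier G" using x openin_subset[OF open_Vg] topspace_eq by auto
        then have "x <# S \<in> lcosets S" unfolding LCOSETS_def by blast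
        then have "x <# S \<in> \<Q>"
          using near l_cosets_close[OF assms(1,2) cov V'(4) Vg gV x] by blast
        then show "x \<in> W" using xG unfolding W_def topspace_eq by simp
      qed
      then show "\<exists>N. openin T N \<and> g \<in> N \<and> N \<subseteq> W" using open_Vg gV by blast
    qed
  qed
qed

end

theorem theorem13:
  fixes G :: "('a, 'b) monoid_scheme" (structure)
    and T :: "'a topology" and S :: "'a set" and \<V> :: "'a set set"
  assumes "topological_group G T"
    and "subgroup S G"
    and "closedin T S"
    and "symmetric_nhd_basis G T \<V>"
  shows "quotient_topology T (\<lambda>g. g <# S) =
           subtopology
             (uniform_topology (hyperspace T) (hyperspace_uniformity T (translate_coverings G \<V>)))
             (lcosets S) \<and>
         uniformly_continuous_between
           (carrier G)
           (entourages_of_coverings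
              (covering_uniformity_with_base (carrier G) (translate_coverings G \<V>)))
           (lcosets S)
           (subspace_uniformity (hyperspace_uniformity T (translate_coverings G \<V>)) (lcosets S))
           (\<lambda>g. g <# S)"
proof -
  interpret topological_group G T by (rule assms(1))
  have "diagonal_uniformity (hyperspace T) (hyperspace_uniformity T (translate_coverings G \<V>))"
    using diagonal_uniformity_hyperspace admissible_translate_coverings translate_coverings_nonempty
      assms(4) by blast
  then have "subtopology
      (uniform_topology (hyperspace T) (hyperspace_uniformity T (translate_coverings G \<V>))) (lcosets S)
    = uniform_topology (lcosets S)
      (subspace_uniformity (hyperspace_uniformity T (translate_coverings G \<V>)) (lcosets S))"
    using subtopology_uniform_topology lcosets_subset_hyperspace[OF assms(2,3)] by blast
  then show ?thesis
    using quotient_topology_eq_uniform_topology[OF assms(2-4)]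
      uniformly_continuous_l_coset[OF assms(2-4)] by simp
qed

end
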